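(* Let $N$ be the number of points $(x_1,\dots,x_n)\in\mathbb{F}_q^{\,n}$, where $n=\max\{n_2,n_4\}$, satisfying simultaneously $$\sum_{i=1}^{r_2}a_{1i}\,\mathrm{x}^{E^{(1)}_i}-b_1=0,\qquad \sum_{j=1}^{r_4}a_{2j}\,\mathrm{x}^{E^{(2)}_j}-b_2=0,$$ with all data as described in the context. Then $$N=\begin{cases} \sum_{i=0}^{4}N_i, & \text{if } n_1<n_3<n_2<n_4,\\ \sum_{i\in\{0,1,3,4\}}N_i, & \text{if } n_2=n_3,\\ \sum_{i\in\{0,2,3,4\}}N_i, & \text{if } n_1=n_3,\ n_2<n_4,\\ \sum_{i\in\{0,1,2,4\}}N_i, & \text{if } n_1<n_3,\ n_2=n_4,\\ \sum_{i\in\{0,2,4\}}N_i, & \text{if } n_1=n_3,\ n_2=n_4,\\ \sum_{i\in\{0,1,2,4,5\}}N_i, & \text{if } n_1<n_3,\ n_2>n_4,\\ \sum_{i\in\{0,2,4,5\}}N_i, & \text{if } n_1=n_3,\ n_2>n_4,\\ \sum_{i\in\{0,1,3,4,6\}}N_i, & \text{if } n_3>n_2. \end{cases}$$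
   Context: Let $p$ be an odd prime, $q$ a power of $p$, $\mathbb{F}_q$ the field with $q$ elements, $\mathbb{F}_q^*=\mathbb{F}_q\setminus\{0\}$. Fix positive integers $r_1,r_2,r_3,r_4,n_1,n_2,n_3,n_4$ with $1\le r_1<r_2$, $1\le r_3<r_4$, $1\le n_1<n_2$, $1\le n_3<n_4$, $n_1\le n_3$, and put $n=\max\{n_2,n_4\}$. Let $b_1,b_2\in\mathbb{F}_q$, $a_{1i}\in\mathbb{F}_q^*$ ($1\le i\le r_2$), $a_{2j}\in\mathbb{F}_q^*$ ($1\le j\le r_4$). Put $\nu^{(1)}_i=n_1$ for $i\le r_1$, $\nu^{(1)}_i=n_2$ for $r_1<i\le r_2$, $\nu^{(2)}_j=n_3$ for $j\le r_3$, $\nu^{(2)}_j=n_4$ for $r_3<j\le r_4$. Let $e^{(1)}_{ik}$ ($1\le k\le \nu^{(1)}_i$) and $e^{(2)}_{jk}$ ($1\le k\le\nu^{(2)}_j$) be positive integers, and set $e^{(1)}_{ik}=0$ for $k>\nu^{(1)}_i$, $e^{(2)}_{jk}=0$ for $k>\nu^{(2)}_j$. Write $E^{(1)}_i=(e^{(1)}_{i1},\dots,e^{(1)}_{in})$, $E^{(2)}_j=(e^{(2)}_{j1},\dots,e^{(2)}_{jn})$ and $\mathrm{x}^{E}=\prod_{k=1}^n x_k^{e_k}$ for $E=(e_1,\dots,e_n)$. Thus the first equation is $\sum_{i=1}^{r_1}a_{1i}x_1^{e^{(1)}_{i1}}\cdots x_{n_1}^{e^{(1)}_{in_1}}+\sum_{i=r_1+1}^{r_2}a_{1i}x_1^{e^{(1)}_{i1}}\cdots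 x_{n_2}^{e^{(1)}_{in_2}}=b_1$, and similarly for the second with $n_3,n_4,r_3,r_4$. Auxiliary quantities. For $l\in\{1,2,3,4\}$ let $I_l=\{i\in\{1,\dots,r_2\}:\nu^{(1)}_i\le n_l\}$ and $J_l=\{j\in\{1,\dots,r_4\}:\nu^{(2)}_j\le n_l\}$ (the terms of each equation involving only $x_1,\dots,x_{n_l}$), and $\rho_l=|I_l|+|J_l|$. Let $E^{(n_l)}$ be the $\rho_l\times n_l$ integer matrix whose rows are $(e^{(1)}_{i1},\dots,e^{(1)}_{in_l})$ for $i\in I_l$ in increasing order followed by $(e^{(2)}_{j1},\dots,e^{(2)}_{jn_l})$ for $j\in J_l$ in increasing order. Choose unimodular integer matrices $U^{(n_l)}$ (order $\rho_l$) and $V^{(n_l)}$ (order $n_l$) with $U^{(n_l)}E^{(n_l)}V^{(n_l)}=\begin{pmatrix}\mathrm{diag}(d^{(l)}_1,\dots,d^{(l)}_{s_l})&0\\0&0\end{pmatrix}$ (Smith normal form), where $d^{(l)}_t$ are positive integers with $d^{(l)}_1\mid d^{(l)}_2\mid\cdots\mid d^{(l)}_{s_l}$. Fix a primitive element $\alpha$ of $\mathbb{F}_q$; for $\beta\in\mathbb{F}_q^*$ let $\mathrm{ind}_\alpha(\beta)$ be the unique integer $r\in[1,q-1]$ with $\beta=\alpha^r$. Let $H_l$ be the number of tuples $((u_i)_{i\in I_l},(v_j)_{j\in J_l})\in(\mathbb{F}_q^* )^{\rho_l}$ such that $\sum_{i\in I_l}a_{1i}u_i=b_1$ and $\sum_{j\in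 J_l}a_{2j}v_j=b_2$ (an empty sum being $0$), and such that, with $w\in\mathbb{Z}^{\rho_l}$ the column vector of the indices $\mathrm{ind}_\alpha(u_i)$ ($i\in I_l$) followed by $\mathrm{ind}_\alpha(v_j)$ ($j\in J_l$) in the same order as the rows of $E^{(n_l)}$, and $(h'_1,\dots,h'_{\rho_l})^T=U^{(n_l)}w$, one has $\gcd(q-1,d^{(l)}_t)\mid h'_t$ for $1\le t\le s_l$ and $(q-1)\mid h'_t$ for $s_l<t\le\rho_l$. Put $L_l=H_l(q-1)^{n_l-s_l}\prod_{t=1}^{s_l}\gcd(q-1,d^{(l)}_t)$. Define: $N_0=q^{n-n_1}(q^{n_1}-(q-1)^{n_1})$ if $b_1=b_2=0$, and $N_0=0$ otherwise. $N_1=q^{n-\min\{n_2,n_3\}}\big(q^{\min\{n_2,n_3\}-n_1}-(q-1)^{\min\{n_2,n_3\}-n_1}\big)L_1$ if $n_1<n_3$ and $b_2=0$; $N_1=q^{n-\min\{n_2,n_4\}}\big(q^{\min\{n_2,n_4\}-n_1}-(q-1)^{\min\{n_2,n_4\}-n_1}\big)L_1$ if $n_1=n_3$ and $b_2=0$; $N_1=0$ otherwise. $N_2=q^{n-\min\{n_2,n_4\}}\big(q^{\min\{n_2,n_4\}-n_3}-(q-1)^{\min\{n_2,n_4\}-n_3}\big)L_3$ if $n_3<n_2$, and $0$ otherwise. $N_3=(q^{n_4-n_2}-(q-1)^{n_4-n_2})L_2$ if $n_1\le n_3<n_2<n_4$; $N_3=(q^{n_4-n_3}-(q-1)^{n_4-n_3})L_3$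 if $n_3\ge n_2$; $N_3=0$ otherwise. $N_4=L_4$ if $n_4\ge n_2$ and $N_4=L_2$ otherwise. $N_5=(q^{n_2-n_4}-(q-1)^{n_2-n_4})L_4$ if $n_2>n_4$, and $0$ otherwise. $N_6=q^{n_4-n_3}(q^{n_3-n_2}-(q-1)^{n_3-n_2})L_2$ if $n_3>n_2$ and $b_2=0$, and $0$ otherwise. *)

theory Defs
  imports "Jordan_Normal_Form.Determinant" "HOL-Library.FuncSet" "HOL-Library.Cardinality"
    "HOL-Computational_Algebra.Primes"
begin

text \<open>
  The parameters \<open>n\<^sub>1, \<dots>, n\<^sub>4\<close> and \<open>r\<^sub>1, \<dots>, r\<^sub>4\<close> are the values \<open>ns l\<close>, \<open>rs l\<close> for
  \<open>l \<in> {1..4}\<close>. The indices of terms, variables and elementary divisors start at 1; the entries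
  of matrices and vectors start at 0. Points and tuples over a finite index set are extensional
  functions.
\<close>

definition nu1 :: "(nat \<Rightarrow> nat) \<Rightarrow> (nat \<Rightarrow> nat) \<Rightarrow> nat \<Rightarrow> nat" where
  "nu1 rs ns i = (if i \<le> rs 1 then ns 1 else ns 2)"

definition nu2 :: "(nat \<Rightarrow> nat) \<Rightarrow> (nat \<Rightarrow> nat) \<Rightarrow> nat \<Rightarrow> nat" where
  "nu2 rs ns j = (if j \<le> rs 3 then ns 3 else ns 4)"

definition I_set :: "(nat \<Rightarrow> nat) \<Rightarrow> (nat \<Rightarrow> nat) \<Rightarrow> nat \<Rightarrow> nat set" where
  "I_set rs ns l = {i \<in> {1..rs 2}. nu1 rs ns i \<le> ns l}"

definition J_set :: "(nat \<Rightarrow> nat) \<Rightarrow> (nat \<Rightarrow> nat) \<Rightarrow> nat \<Rightarrow> nat set" where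
  "J_set rs ns l = {j \<in> {1..rs 4}. nu2 rs ns j \<le> ns l}"

definition rho :: "(nat \<Rightarrow> nat) \<Rightarrow> (nat \<Rightarrow> nat) \<Rightarrow> nat \<Rightarrow> nat" where
  "rho rs ns l = card (I_set rs ns l) + card (J_set rs ns l)"

definition stack :: "(nat \<Rightarrow> nat) \<Rightarrow> (nat \<Rightarrow> nat) \<Rightarrow> nat \<Rightarrow> (nat \<Rightarrow> 'c) \<Rightarrow> (nat \<Rightarrow> 'c) \<Rightarrow> 'c list" where
  "stack rs ns l f g =
     map f (sorted_list_of_set (I_set rs ns l)) @ map g (sorted_list_of_set (J_set rs ns l))"

definition exp_mat ::
    "(nat \<Rightarrow> nat) \<Rightarrow> (nat \<Rightarrow> nat) \<Rightarrow> (nat \<Rightarrow> nat \<Rightarrow> nat) \<Rightarrow> (nat \<Rightarrow> nat \<Rightarrow> nat) \<Rightarrow> nat \<Rightarrow> int mat" where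
  "exp_mat rs ns e1 e2 l =
     mat (rho rs ns l) (ns l) (\<lambda>(t, k). int ((stack rs ns l e1 e2 ! t) (Suc k)))"

definition unimodular :: "nat \<Rightarrow> int mat \<Rightarrow> bool" where
  "unimodular k U \<longleftrightarrow> U \<in> carrier_mat k k \<and> (det U = 1 \<or> det U = - 1)"

definition smith_decomposition ::
    "int mat \<Rightarrow> int mat \<Rightarrow> int mat \<Rightarrow> nat \<Rightarrow> (nat \<Rightarrow> nat) \<Rightarrow> bool" where
  "smith_decomposition E U V s d \<longleftrightarrow>
     unimodular (dim_row E) U \<and> unimodular (dim_col E) V \<and>
     s \<le> dim_row E \<and> s \<le> dim_col E \<and>
     (\<forall>t\<in>{1..s}. 0 < d t) \<and> (\<forall>t\<in>{1..<s}. d t dvd d (Suc t)) \<and>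
     U * E * V = mat (dim_row E) (dim_col E)
       (\<lambda>(i, j). if i = j \<and> i < s then int (d (Suc i)) else 0)"

definition primitive_element :: "'a::field \<Rightarrow> bool" where
  "primitive_element \<alpha> \<longleftrightarrow> \<alpha> \<noteq> 0 \<and> (\<forall>\<beta>. \<beta> \<noteq> 0 \<longrightarrow> (\<exists>k::nat. \<beta> = \<alpha> ^ k))"

definition ind :: "nat \<Rightarrow> 'a::field \<Rightarrow> 'a \<Rightarrow> nat" where
  "ind q \<alpha> \<beta> = (THE k. k \<in> {1..q - 1} \<and> \<beta> = \<alpha> ^ k)"

definition H_count ::
    "nat \<Rightarrow> 'a::field \<Rightarrow> (nat \<Rightarrow> nat) \<Rightarrow> (nat \<Rightarrow> nat) \<Rightarrow> (nat \<Rightarrow> 'a) \<Rightarrow> (nat \<Rightarrow> 'a) \<Rightarrow> 'a \<Rightarrow> 'a \<Rightarrow>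
     int mat \<Rightarrow> nat \<Rightarrow> (nat \<Rightarrow> nat) \<Rightarrow> nat \<Rightarrow> nat" where
  "H_count q \<alpha> rs ns a1 a2 b1 b2 U s d l =
     card {(u, v). u \<in> I_set rs ns l \<rightarrow>\<^sub>E (UNIV - {0}) \<and> v \<in> J_set rs ns l \<rightarrow>\<^sub>E (UNIV - {0}) \<and>
       (\<Sum>i\<in>I_set rs ns l. a1 i * u i) = b1 \<and> (\<Sum>j\<in>J_set rs ns l. a2 j * v j) = b2 \<and>
       (let w = vec_of_list (stack rs ns l (\<lambda>i. int (ind q \<alpha> (u i))) (\<lambda>j. int (ind q \<alpha> (v j))));
            h = U *\<^sub>v w
        in (\<forall>t\<in>{1..s}. int (gcd (q - 1) (d t)) dvd h $ (t - 1)) \<and>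
           (\<forall>t\<in>{s + 1..rho rs ns l}. int (q - 1) dvd h $ (t - 1)))}"

definition L_count ::
    "nat \<Rightarrow> 'a::field \<Rightarrow> (nat \<Rightarrow> nat) \<Rightarrow> (nat \<Rightarrow> nat) \<Rightarrow> (nat \<Rightarrow> 'a) \<Rightarrow> (nat \<Rightarrow> 'a) \<Rightarrow> 'a \<Rightarrow> 'a \<Rightarrow>
     int mat \<Rightarrow> nat \<Rightarrow> (nat \<Rightarrow> nat) \<Rightarrow> nat \<Rightarrow> nat" where
  "L_count q \<alpha> rs ns a1 a2 b1 b2 U s d l =
     H_count q \<alpha> rs ns a1 a2 b1 b2 U s d l * (q - 1) ^ (ns l - s) * (\<Prod>t=1..s. gcd (q - 1) (d t))"

text \<open>
  In the functions below, \<open>L l\<close> stands for \<open>L\<^sub>l\<close>. For parameters ordered as in the theorem, no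
  subtraction in a selected branch is truncated.
\<close>

definition N0 :: "nat \<Rightarrow> nat \<Rightarrow> (nat \<Rightarrow> nat) \<Rightarrow> 'a::field \<Rightarrow> 'a \<Rightarrow> nat" where
  "N0 q n ns b1 b2 =
     (if b1 = 0 \<and> b2 = 0 then q ^ (n - ns 1) * (q ^ ns 1 - (q - 1) ^ ns 1) else 0)"

definition N1 :: "nat \<Rightarrow> nat \<Rightarrow> (nat \<Rightarrow> nat) \<Rightarrow> 'a::field \<Rightarrow> (nat \<Rightarrow> nat) \<Rightarrow> nat" where
  "N1 q n ns b2 L =
     (if ns 1 < ns 3 \<and> b2 = 0 then
        q ^ (n - min (ns 2) (ns 3)) *
        (q ^ (min (ns 2) (ns 3) - ns 1) - (q - 1) ^ (min (ns 2) (ns 3) - ns 1)) * L 1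
      else if ns 1 = ns 3 \<and> b2 = 0 then
        q ^ (n - min (ns 2) (ns 4)) *
        (q ^ (min (ns 2) (ns 4) - ns 1) - (q - 1) ^ (min (ns 2) (ns 4) - ns 1)) * L 1
      else 0)"

definition N2 :: "nat \<Rightarrow> nat \<Rightarrow> (nat \<Rightarrow> nat) \<Rightarrow> (nat \<Rightarrow> nat) \<Rightarrow> nat" where
  "N2 q n ns L =
     (if ns 3 < ns 2 then
        q ^ (n - min (ns 2) (ns 4)) *
        (q ^ (min (ns 2) (ns 4) - ns 3) - (q - 1) ^ (min (ns 2) (ns 4) - ns 3)) * L 3
      else 0)"

definition N3 :: "nat \<Rightarrow> (nat \<Rightarrow> nat) \<Rightarrow> (nat \<Rightarrow> nat) \<Rightarrow> nat" where
  "N3 q ns L =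
     (if ns 1 \<le> ns 3 \<and> ns 3 < ns 2 \<and> ns 2 < ns 4 then
        (q ^ (ns 4 - ns 2) - (q - 1) ^ (ns 4 - ns 2)) * L 2
      else if ns 3 \<ge> ns 2 then (q ^ (ns 4 - ns 3) - (q - 1) ^ (ns 4 - ns 3)) * L 3
      else 0)"

definition N4 :: "(nat \<Rightarrow> nat) \<Rightarrow> (nat \<Rightarrow> nat) \<Rightarrow> nat" where
  "N4 ns L = (if ns 4 \<ge> ns 2 then L 4 else L 2)"

definition N5 :: "nat \<Rightarrow> (nat \<Rightarrow> nat) \<Rightarrow> (nat \<Rightarrow> nat) \<Rightarrow> nat" where
  "N5 q ns L =
     (if ns 2 > ns 4 then (q ^ (ns 2 - ns 4) - (q - 1) ^ (ns 2 - ns 4)) * L 4 else 0)"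

definition N6 :: "nat \<Rightarrow> (nat \<Rightarrow> nat) \<Rightarrow> 'a::field \<Rightarrow> (nat \<Rightarrow> nat) \<Rightarrow> nat" where
  "N6 q ns b2 L =
     (if ns 3 > ns 2 \<and> b2 = 0 then
        q ^ (ns 4 - ns 3) * (q ^ (ns 3 - ns 2) - (q - 1) ^ (ns 3 - ns 2)) * L 2
      else 0)"

end

theory Submission
  imports Defs
begin

text \<open>
  An integer matrix \<open>M\<close> acts on tuples of nonzero field elements by
  \<open>(x\<^sub>j)\<^sub>j \<mapsto> (\<Prod>\<^sub>j x\<^sub>j ^ M\<^sub>i\<^sub>j)\<^sub>i\<close>, compatibly with matrix products, so unimodular matrices act
  bijectively. With \<open>U E V = D\<close> in Smith form and \<open>x = V z\<close>, the system \<open>E x = w\<close> becomes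
  \<open>D z = U w\<close>, which splits into equations \<open>z ^ d = \<alpha> ^ h\<close> in a cyclic group of order \<open>q - 1\<close>;
  each has \<open>gcd (q - 1) d\<close> solutions if this number divides \<open>h\<close>, and none otherwise. Summing over
  the values \<open>w\<close> of the monomials gives \<open>L\<^sub>l\<close> as the number of solutions with all coordinates nonzero
  of the system truncated to the terms in \<open>x\<^sub>1, \<dots>, x\<^bsub>n\<^sub>l\<^esub>\<close>.

  The points of the affine space are stratified by the position of their first zero coordinate. If it
  lies in \<open>{A<..B}\<close> and no term has its last variable strictly between \<open>x\<^sub>A\<close> and \<open>x\<^sub>B\<close>, exactly the
  terms in \<open>x\<^sub>1, \<dots>, x\<^sub>A\<close> survive and the remaining coordinates are otherwise free, which
  contributes \<open>q ^ (n - B) * (q ^ (B - A) - (q - 1) ^ (B - A))\<close> times the number of solutions of the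
  truncated system.
\<close>

section \<open>Primitive elements and power equations\<close>

lemma card_field_minus_one_pos: "CARD('a::{field,finite}) - 1 > 0"
proof -
  have "card {0, 1 :: 'a} \<le> CARD('a)" by (intro card_mono) auto
  then show ?thesis by simp
qed

text \<open>Multiplication by \<open>x\<close> permutes the nonzero elements, so their product is
  unchanged; cancelling it leaves the power of \<open>x\<close>.\<close>

lemma nonzero_power_card:
  fixes x :: "'a::{field,finite}"
  assumes "x \<noteq> 0"
  shows "x ^ (CARD('a) - 1) = 1"
proof -
  let ?G = "UNIV - {0 :: 'a}"
  have "(\<Prod>y\<in>?G. x * y) = \<Prod>?G"
    by (rule prod.reindex_bij_witness[where i="\<lambda>y. y / x" and j="\<lambda>y. x * y"]) (use assms in auto)
  then have "x ^ card ?G * \<Prod>?G = 1 * \<Prod>?G" by (simp add: prod.distrib)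
  moreover have "\<Prod>?G \<noteq> 0" by simp
  ultimately show ?thesis by simp
qed

lemma power_int_sum:
  fixes x :: "'a::field"
  assumes "x \<noteq> 0"
  shows "x powi (\<Sum>l\<in>A. f l) = (\<Prod>l\<in>A. x powi f l)"
  by (induction A rule: infinite_finite_induct) (use assms in \<open>auto simp: power_int_add\<close>)

lemma power_int_prod:
  fixes f :: "'b \<Rightarrow> 'a::field"
  shows "(\<Prod>j\<in>A. f j) powi k = (\<Prod>j\<in>A. f j powi k)"
  by (induction A rule: infinite_finite_induct) (auto simp: power_int_mult_distrib)

text \<open>Exponents only matter modulo \<open>CARD('a) - 1\<close>, so those below it already
  reach every nonzero element; injectivity follows because both sets have the same size.\<close>

lemma bij_betw_primitive_power:
  fixes \<alpha> :: "'a::{field,finite}"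
  assumes "primitive_element \<alpha>"
  shows "bij_betw (\<lambda>k. \<alpha> ^ k) {..<CARD('a) - 1} (UNIV - {0})"
proof -
  let ?Q = "CARD('a) - 1"
  have nz: "\<alpha> \<noteq> 0" using assms by (simp add: primitive_element_def)
  have Q: "?Q > 0" by (rule card_field_minus_one_pos)
  have red: "\<alpha> ^ k = \<alpha> ^ (k mod ?Q)" for k
  proof -
    have "\<alpha> ^ k = \<alpha> ^ (?Q * (k div ?Q) + k mod ?Q)" by (simp only: mult_div_mod_eq)
    then show ?thesis using nonzero_power_card[OF nz] by (simp only: power_add power_mult power_one mult_1)
  qed
  have im: "(\<lambda>k. \<alpha> ^ k) ` {..<?Q} = UNIV - {0}"
  proof (intro equalityI subsetI)
    fix \<beta> :: 'a assume "\<beta> \<in> UNIV - {0}"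
    then obtain k where "\<beta> = \<alpha> ^ k" using assms by (auto simp: primitive_element_def)
    then show "\<beta> \<in> (\<lambda>k. \<alpha> ^ k) ` {..<?Q}" using red[of k] Q by auto
  qed (use nz in auto)
  then have "inj_on (\<lambda>k. \<alpha> ^ k) {..<?Q}"
    by (intro eq_card_imp_inj_on) (simp_all add: card_Diff_singleton)
  with im show ?thesis by (simp add: bij_betw_def)
qed

text \<open>Division with remainder reduces \<open>k\<close> to the range where powers of
  \<open>\<alpha>\<close> are distinct, and there only exponent 0 gives 1.\<close>

lemma primitive_power_int_eq_1_iff:
  fixes \<alpha> :: "'a::{field,finite}"
  assumes "primitive_element \<alpha>"
  shows "\<alpha> powi k = 1 \<longleftrightarrow> int (CARD('a) - 1) dvd k"
proof -
  let ?Q = "CARD('a) - 1"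
  have nz: "\<alpha> \<noteq> 0" using assms by (simp add: primitive_element_def)
  have one: "\<alpha> powi int ?Q = 1" using nonzero_power_card[OF nz] by (simp only: power_int_of_nat)
  have Q: "?Q > 0" by (rule card_field_minus_one_pos)
  define r where "r = nat (k mod int ?Q)"
  have r: "int r = k mod int ?Q" "r < ?Q" using Q by (auto simp: r_def nat_less_iff)
  have "\<alpha> powi k = \<alpha> powi (int ?Q * (k div int ?Q) + int r)" using r by simp
  also have "\<dots> = \<alpha> ^ r" using nz one by (simp only: power_int_add power_int_mult power_int_1_left power_int_of_nat mult_1 simp_thms)
  finally have "\<alpha> powi k = 1 \<longleftrightarrow> \<alpha> ^ r = \<alpha> ^ 0" by simp
  also have "\<dots> \<longleftrightarrow> r = 0"
    using inj_on_eq_iff[OF bij_betw_imp_inj_on[OF bij_betw_primitive_power[OF assms]], of r 0] r Q by auto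
  also have "\<dots> \<longleftrightarrow> int ?Q dvd k" using r by (auto simp: dvd_eq_mod_eq_0)
  finally show ?thesis .
qed

lemma primitive_power_ind:
  fixes \<alpha> :: "'a::{field,finite}"
  assumes "primitive_element \<alpha>" "\<beta> \<noteq> 0"
  shows "\<alpha> ^ ind (CARD('a)) \<alpha> \<beta> = \<beta>"
proof -
  let ?Q = "CARD('a) - 1"
  have nz: "\<alpha> \<noteq> 0" using assms by (simp add: primitive_element_def)
  have Q: "?Q > 0" by (rule card_field_minus_one_pos)
  note bij = bij_betw_primitive_power[OF assms(1)]
  have "\<exists>!k. k \<in> {1..?Q} \<and> \<beta> = \<alpha> ^ k"
  proof -
    \<comment> \<open>\<open>ind\<close> takes values in \<open>{1..CARD('a) - 1}\<close>, whereas
      the bijection starts at exponent 0; dividing by \<open>\<alpha>\<close> accounts for the shift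
      by one.\<close>
    have "\<beta> / \<alpha> \<in> UNIV - {0}" using assms nz by simp
    then have "\<beta> / \<alpha> \<in> (\<lambda>k. \<alpha> ^ k) ` {..<?Q}" using bij_betw_imp_surj_on[OF bij] by simp
    then obtain k where k: "k < ?Q" "\<beta> / \<alpha> = \<alpha> ^ k" by blast
    have "j = Suc k" if j: "j \<in> {1..?Q} \<and> \<beta> = \<alpha> ^ j" for j
    proof -
      obtain j' where "j = Suc j'" using j by (cases j) auto
      then show ?thesis using j k nz inj_onD[OF bij_betw_imp_inj_on[OF bij], of j' k] by auto
    qed
    moreover have "Suc k \<in> {1..?Q} \<and> \<beta> = \<alpha> ^ Suc k" using k nz by (auto simp: field_simps)
    ultimately show ?thesis by blast
  qed
  from theI'[OF this] show ?thesis unfolding ind_def by simp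
qed

text \<open>The solutions are empty or a coset of the kernel of \<open>z \<mapsto> z ^ d\<close> on
  the cyclic group of nonzero elements. The kernel has \<open>gcd (CARD('a) - 1) d\<close> elements,
  and Bezout decides when a solution exists.\<close>

lemma card_roots:
  fixes \<alpha> :: "'a::{field,finite}"
  assumes "primitive_element \<alpha>" "d > 0"
  shows "card {z. z \<noteq> 0 \<and> z ^ d = \<alpha> powi k} =
    (if int (gcd (CARD('a) - 1) d) dvd k then gcd (CARD('a) - 1) d else 0)"
proof -
  define Q where "Q = CARD('a) - 1"
  define g where "g = gcd Q d"
  have nz: "\<alpha> \<noteq> 0" using assms by (simp add: primitive_element_def)
  have Q: "Q > 0" unfolding Q_def by (rule card_field_minus_one_pos)
  have g: "g > 0" using Q by (simp add: g_def)
  note bij = bij_betw_primitive_power[OF assms(1), folded Q_def]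
  note one = primitive_power_int_eq_1_iff[OF assms(1), folded Q_def]
  define Q' where "Q' = Q div g"
  have Q': "Q = Q' * g" "Q' > 0" using Q using div_greater_zero_iff[of Q g] g by (auto simp: Q'_def g_def intro: dvd_imp_le)
  \<comment> \<open>Once \<open>g\<close> is cancelled, \<open>Q'\<close> is coprime to the cofactor
    of \<open>d\<close>. Hence \<open>\<alpha> ^ j\<close> is a \<open>d\<close>-th root of unity
    exactly when \<open>Q'\<close> divides \<open>j\<close>, which leaves \<open>g\<close> exponents
    below \<open>Q\<close>.\<close>
  have dj: "Q dvd d * j \<longleftrightarrow> Q' dvd j" for j
  proof -
    define d' where "d' = d div g"
    have d': "d = d' * g" by (simp add: d'_def g_def)
    have "coprime Q' d'" unfolding Q'_def d'_def g_def using Q by (intro div_gcd_coprime) auto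
    then show ?thesis using g unfolding Q' d' by (simp add: coprime_dvd_mult_right_iff ac_simps)
  qed
  have ker: "card {z::'a. z \<noteq> 0 \<and> z ^ d = 1} = g"
  proof -
    have "bij_betw (\<lambda>i. \<alpha> ^ (Q' * i)) {..<g} {z::'a. z \<noteq> 0 \<and> z ^ d = 1}"
    proof (rule bij_betw_imageI)
      show "inj_on (\<lambda>i. \<alpha> ^ (Q' * i)) {..<g}"
      proof (rule inj_onI)
        fix i j assume "i \<in> {..<g}" "j \<in> {..<g}" "\<alpha> ^ (Q' * i) = \<alpha> ^ (Q' * j)"
        then have "Q' * i = Q' * j" using Q'
          by (intro inj_onD[OF bij_betw_imp_inj_on[OF bij]]) auto
        then show "i = j" using Q' by simp
      qed
      have iff: "(\<alpha> ^ j) ^ d = 1 \<longleftrightarrow> Q' dvd j" for j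
        using one[of "int (d * j)"] dj[of j]
        by (simp add: power_mult[symmetric] mult.commute power_int_of_nat del: of_nat_mult)
      show "(\<lambda>i. \<alpha> ^ (Q' * i)) ` {..<g} = {z. z \<noteq> 0 \<and> z ^ d = 1}"
      proof (intro equalityI subsetI)
        fix z assume z: "z \<in> {z::'a. z \<noteq> 0 \<and> z ^ d = 1}"
        then have "z \<in> (\<lambda>k. \<alpha> ^ k) ` {..<Q}" using bij_betw_imp_surj_on[OF bij] by simp
        then obtain j where j: "j < Q" "z = \<alpha> ^ j" by blast
        with z iff obtain i where "j = Q' * i" by auto
        with j have "i < g" "z = \<alpha> ^ (Q' * i)" using Q' by simp_all
        then show "z \<in> (\<lambda>i. \<alpha> ^ (Q' * i)) ` {..<g}" by blast
      qed (auto simp: nz iff)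
    qed
    then show ?thesis using bij_betw_same_card by fastforce
  qed
  have ex: "(\<exists>z. z \<noteq> 0 \<and> z ^ d = \<alpha> powi k) \<longleftrightarrow> int g dvd k"
  proof
    assume "\<exists>z. z \<noteq> 0 \<and> z ^ d = \<alpha> powi k"
    then obtain z where z: "z \<noteq> 0" "z ^ d = \<alpha> powi k" by blast
    obtain j where "z = \<alpha> ^ j" using assms z by (auto simp: primitive_element_def)
    then have "\<alpha> powi (int (j * d) - k) = 1" using z nz by (simp add: power_int_diff power_mult del: of_nat_mult)
    then have "int Q dvd int (j * d) - k" using one by simp
    then have "int g dvd int (j * d) - k" using Q' by (metis dvd_trans dvd_triv_right of_nat_mult)
    moreover have "int g dvd int (j * d)" unfolding int_dvd_int_iff by (simp add: g_def)
    ultimately show "int g dvd k" by (metis dvd_diff_right_iff dvd_diff_commute zdvd_zdiffD)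
  next
    assume "int g dvd k"
    then obtain c where c: "k = int g * c" by blast
    \<comment> \<open>Multiplied by \<open>c\<close>, the Bezout identity says that
      \<open>v * c * d\<close> and \<open>k\<close> differ by a multiple of \<open>Q\<close>, so
      \<open>\<alpha> powi (v * c)\<close> is the required root.\<close>
    obtain u v where uv: "u * int Q + v * int d = int g"
      using bezout_int[of "int Q" "int d"] by (auto simp: g_def)
    have "(\<alpha> powi (v * c)) ^ d = \<alpha> powi k * (\<alpha> powi (int Q * (- u * c)))"
    proof -
      have "k + int Q * (- u * c) = v * c * int d" unfolding c uv[symmetric] by (simp add: algebra_simps)
      then have "(\<alpha> powi (v * c)) ^ d = \<alpha> powi (k + int Q * (- u * c))" by (simp only: power_int_power')
      also have "\<dots> = \<alpha> powi k * (\<alpha> powi (int Q * (- u * c)))" using nz by (intro power_int_add) simp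
      finally show ?thesis .
    qed
    also have "\<alpha> powi (int Q * (- u * c)) = 1" using one by simp
    finally show "\<exists>z. z \<noteq> 0 \<and> z ^ d = \<alpha> powi k" using nz by (intro exI[of _ "\<alpha> powi (v * c)"]) auto
  qed
  show ?thesis
  proof (cases "int g dvd k")
    case True
    with ex obtain y where y: "y \<noteq> 0" "y ^ d = \<alpha> powi k" by blast
    have "bij_betw ((*) y) {z. z \<noteq> 0 \<and> z ^ d = 1} {z. z \<noteq> 0 \<and> z ^ d = \<alpha> powi k}"
      by (rule bij_betw_byWitness[where f'="\<lambda>z. z / y"])
         (use y nz in \<open>auto simp: power_mult_distrib power_divide\<close>)
    then show ?thesis using ker True bij_betw_same_card by (fastforce simp: g_def Q_def)
  next
    case False
    then have "{z. z \<noteq> 0 \<and> z ^ d = \<alpha> powi k} = {}" using ex by blast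
    with False show ?thesis by (simp only: card.empty g_def Q_def if_False)
  qed
qed

section \<open>Monomial maps of integer matrices\<close>

text \<open>Exponents are integers because unimodular matrices may have negative entries. The result
  is extensional, so that an inverse matrix gives an inverse map between spaces of tuples.\<close>

definition monom_map :: "int mat \<Rightarrow> (nat \<Rightarrow> 'a::field) \<Rightarrow> nat \<Rightarrow> 'a" where
  "monom_map M x = (\<lambda>i\<in>{..<dim_row M}. \<Prod>j<dim_col M. x j powi (M $$ (i, j)))"

lemma monom_map_PiE:
  assumes "M \<in> carrier_mat r c" "\<And>j. j < c \<Longrightarrow> x j \<noteq> 0"
  shows "monom_map M x \<in> {..<r} \<rightarrow>\<^sub>E UNIV - {0}"
  using assms by (auto simp: monom_map_def)

text \<open>Associativity of the matrix action in multiplicative notation: the double product is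
  interchanged. Nonzero coordinates make \<open>powi\<close> turn sums of exponents into
  products.\<close>

lemma monom_map_mult:
  assumes M: "M \<in> carrier_mat r c" and N: "N \<in> carrier_mat c k"
    and nz: "\<And>j. j < k \<Longrightarrow> x j \<noteq> 0"
  shows "monom_map (M * N) x = monom_map M (monom_map N x)"
proof
  fix i
  show "monom_map (M * N) x i = monom_map M (monom_map N x) i"
  proof (cases "i < r")
    case True
    have "monom_map (M * N) x i = (\<Prod>j<k. x j powi (\<Sum>l<c. N $$ (l, j) * M $$ (i, l)))"
      using M N True
      by (auto simp: monom_map_def scalar_prod_def lessThan_atLeast0 mult.commute intro!: prod.cong sum.cong
          arg_cong2[where f=power_int])
    also have "\<dots> = (\<Prod>j<k. \<Prod>l<c. (x j powi N $$ (l, j)) powi M $$ (i, l))"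
      by (intro prod.cong refl) (simp add: power_int_sum nz power_int_mult)
    also have "\<dots> = (\<Prod>l<c. (\<Prod>j<k. x j powi N $$ (l, j)) powi M $$ (i, l))"
      by (subst prod.swap) (simp add: power_int_prod)
    also have "\<dots> = monom_map M (monom_map N x) i"
      using M N True by (auto simp: monom_map_def)
    finally show ?thesis .
  qed (use M in \<open>auto simp: monom_map_def\<close>)
qed

lemma monom_map_one:
  assumes "x \<in> {..<n} \<rightarrow>\<^sub>E A"
  shows "monom_map (1\<^sub>m n) x = x"
proof
  fix i
  show "monom_map (1\<^sub>m n) x i = x i"
  proof (cases "i < n")
    case True
    then have "monom_map (1\<^sub>m n) x i = (\<Prod>j<n. x j powi (1\<^sub>m n $$ (i, j)))"
      by (simp add: monom_map_def)
    also have "\<dots> = (\<Prod>j<n. if j = i then x j else 1)"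
      using True by (intro prod.cong) auto
    finally show ?thesis using True by simp
  qed (use assms in \<open>auto simp: monom_map_def PiE_def extensional_def\<close>)
qed

text \<open>As \<open>det V\<close> is its own inverse, \<open>det V\<close> times the adjugate is
  an integer inverse of \<open>V\<close>, and its monomial map inverts that of
  \<open>V\<close>.\<close>

lemma bij_betw_monom_map:
  assumes "unimodular n V"
  shows "bij_betw (monom_map V) ({..<n} \<rightarrow>\<^sub>E UNIV - {0}) ({..<n} \<rightarrow>\<^sub>E UNIV - {0 :: 'a::field})"
proof -
  let ?T = "{..<n} \<rightarrow>\<^sub>E UNIV - {0 :: 'a}"
  have V: "V \<in> carrier_mat n n" and det: "det V * det V = 1"
    using assms by (auto simp: unimodular_def)
  define W where "W = det V \<cdot>\<^sub>m adj_mat V"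
  note adj = adj_mat[OF V]
  have W: "W \<in> carrier_mat n n" using adj by (simp add: W_def)
  have id: "det V \<cdot>\<^sub>m (det V \<cdot>\<^sub>m 1\<^sub>m n) = 1\<^sub>m n"
    by (rule eq_matI) (auto simp: det mult.assoc[symmetric])
  have VW: "V * W = 1\<^sub>m n"
    unfolding W_def mult_smult_distrib[OF V adj(1)] adj(2) by (rule id)
  have WV: "W * V = 1\<^sub>m n"
    unfolding W_def mult_smult_assoc_mat[OF adj(1) V] adj(3) by (rule id)
  have "monom_map W (monom_map V x) = x" if "x \<in> ?T" for x
    using that monom_map_mult[OF W V, of x, symmetric] monom_map_one[OF that] WV by (simp add: PiE_iff)
  moreover have "monom_map V (monom_map W x) = x" if "x \<in> ?T" for x
    using that monom_map_mult[OF V W, of x, symmetric] monom_map_one[OF that] VW by (simp add: PiE_iff)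
  moreover have "monom_map V ` ?T \<subseteq> ?T" "monom_map W ` ?T \<subseteq> ?T"
    by (intro image_subsetI monom_map_PiE[OF V] monom_map_PiE[OF W]; auto)+
  ultimately show ?thesis by (intro bij_betw_byWitness[where f'="monom_map W"]) blast+
qed

section \<open>Diagonal systems and fibers of monomial maps\<close>

lemma monom_map_diag:
  assumes D: "D = mat r n (\<lambda>(i, j). if i = j \<and> i < s then int (d (Suc i)) else 0)"
    and "s \<le> n" "i < r"
  shows "monom_map D z i = (if i < s then z i ^ d (Suc i) else 1)"
proof -
  have "monom_map D z i = (\<Prod>j<n. z j powi (D $$ (i, j)))"
    using assms by (simp add: monom_map_def)
  also have "\<dots> = (\<Prod>j<n. if j = i then (if i < s then z i ^ d (Suc i) else 1) else 1)"
    using assms by (intro prod.cong) auto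
  finally show ?thesis using assms by auto
qed

text \<open>Passing to exponents of \<open>\<alpha>\<close> turns the multiplicative action into the
  ordinary matrix-vector product; this is how \<open>U\<close> comes to act on the vector of
  indices.\<close>

lemma monom_map_powers:
  fixes \<alpha> :: "'a::field"
  assumes U: "U \<in> carrier_mat r r" and h: "h \<in> carrier_vec r" and i: "i < r" and nz: "\<alpha> \<noteq> 0"
  shows "monom_map U (\<lambda>j\<in>{..<r}. \<alpha> powi (h $ j)) i = \<alpha> powi ((U *\<^sub>v h) $ i)"
proof -
  have "(U *\<^sub>v h) $ i = (\<Sum>j<r. h $ j * U $$ (i, j))"
    using assms by (auto simp: scalar_prod_def lessThan_atLeast0 mult.commute intro!: sum.cong)
  then show ?thesis using assms by (simp add: monom_map_def power_int_sum power_int_mult)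
qed

text \<open>The coordinates decouple: each of the first \<open>s\<close> satisfies a power equation
  counted by \<open>card_roots\<close>, and the other \<open>n - s\<close> are arbitrary nonzero
  elements. Rows from \<open>s\<close> on have left-hand side 1 and hence only constrain
  \<open>h\<close>.\<close>

lemma card_diag_solutions:
  fixes \<alpha> :: "'a::{field,finite}"
  assumes \<alpha>: "primitive_element \<alpha>" and s: "s \<le> n" "s \<le> r" and d: "\<forall>t\<in>{1..s}. 0 < d t"
    and D: "D = mat r n (\<lambda>(i, j). if i = j \<and> i < s then int (d (Suc i)) else 0)"
  shows "card {z \<in> {..<n} \<rightarrow>\<^sub>E UNIV - {0}. \<forall>i<r. monom_map D z i = \<alpha> powi h i} =
    (if (\<forall>t<s. int (gcd (CARD('a) - 1) (d (Suc t))) dvd h t) \<and> (\<forall>t\<in>{s..<r}. int (CARD('a) - 1) dvd h t)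
     then (CARD('a) - 1) ^ (n - s) * (\<Prod>t<s. gcd (CARD('a) - 1) (d (Suc t))) else 0)"
proof -
  let ?Q = "CARD('a) - 1"
  let ?S = "{z \<in> {..<n} \<rightarrow>\<^sub>E UNIV - {0}. \<forall>i<r. monom_map D z i = \<alpha> powi h i}"
  have mm: "monom_map D z i = (if i < s then z i ^ d (Suc i) else 1)" if "i < r" for z :: "nat \<Rightarrow> 'a" and i
    using monom_map_diag[OF D s(1) that] .
  show ?thesis
  proof (cases "\<forall>t\<in>{s..<r}. int ?Q dvd h t")
    case False
    then obtain t where "t \<in> {s..<r}" "\<alpha> powi h t \<noteq> 1"
      using primitive_power_int_eq_1_iff[OF \<alpha>] by blast
    then have "?S = {}" using mm[of t] by auto
    with False show ?thesis by (simp only: card.empty simp_thms if_False)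
  next
    case True
    \<comment> \<open>\<open>B j\<close> collects the admissible values of coordinate
      \<open>j\<close>, so the solution set is a product. \<open>Suc j\<close> appears because
      elementary divisors are numbered from 1.\<close>
    define B where "B j = (if j < s then {z. z \<noteq> 0 \<and> z ^ d (Suc j) = \<alpha> powi h j} else UNIV - {0})" for j
    have "\<alpha> powi h t = 1" if "s \<le> t" "t < r" for t
      using True that primitive_power_int_eq_1_iff[OF \<alpha>] by auto
    then have "?S = (\<Pi>\<^sub>E j\<in>{..<n}. B j)"
      using s by (fastforce simp: mm B_def PiE_iff split: if_splits)
    then have "card ?S = (\<Prod>j<n. card (B j))" by (simp add: card_PiE)
    also have "\<dots> = (\<Prod>j<s. card (B j)) * (\<Prod>j\<in>{s..<n}. card (B j))"
    proof -
      have "{..<n} = {..<s} \<union> {s..<n}" using s by auto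
      then show ?thesis by (simp add: prod.union_disjoint ivl_disj_int)
    qed
    also have "(\<Prod>j\<in>{s..<n}. card (B j)) = ?Q ^ (n - s)"
      by (simp add: B_def card_Diff_singleton)
    also have "(\<Prod>j<s. card (B j)) =
        (\<Prod>j<s. if int (gcd ?Q (d (Suc j))) dvd h j then gcd ?Q (d (Suc j)) else 0)"
      using d by (intro prod.cong refl) (subst card_roots[OF \<alpha>, symmetric], auto simp: B_def)
    also have "\<dots> = (if \<forall>j<s. int (gcd ?Q (d (Suc j))) dvd h j then \<Prod>j<s. gcd ?Q (d (Suc j)) else 0)"
      by (auto simp del: of_nat_diff)
    finally show ?thesis using True by (simp only: mult.commute simp_thms mult_0 mult_0_right split: if_splits) (simp)
  qed
qed

text \<open>The substitution \<open>x = monom_map V z\<close> and an application of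
  \<open>monom_map U\<close> to both sides, both bijective, reduce the equation to the diagonal
  system with exponents \<open>U *\<^sub>v h\<close>.\<close>

lemma card_monom_map_fiber:
  fixes \<alpha> :: "'a::{field,finite}"
  assumes \<alpha>: "primitive_element \<alpha>" and E: "E \<in> carrier_mat r n"
    and smith: "smith_decomposition E U V s d" and h: "h \<in> carrier_vec r"
  shows "card {x \<in> {..<n} \<rightarrow>\<^sub>E UNIV - {0}. monom_map E x = (\<lambda>i\<in>{..<r}. \<alpha> powi (h $ i))} =
    (if (\<forall>t<s. int (gcd (CARD('a) - 1) (d (Suc t))) dvd (U *\<^sub>v h) $ t) \<and>
        (\<forall>t\<in>{s..<r}. int (CARD('a) - 1) dvd (U *\<^sub>v h) $ t)
     then (CARD('a) - 1) ^ (n - s) * (\<Prod>t<s. gcd (CARD('a) - 1) (d (Suc t))) else 0)"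
proof -
  let ?T = "{..<n} \<rightarrow>\<^sub>E UNIV - {0 :: 'a}"
  let ?w = "\<lambda>i\<in>{..<r}. \<alpha> powi (h $ i)"
  have nz: "\<alpha> \<noteq> 0" using \<alpha> by (simp add: primitive_element_def)
  define D where "D = mat r n (\<lambda>(i, j). if i = j \<and> i < s then int (d (Suc i)) else 0)"
  have uU: "unimodular r U" and uV: "unimodular n V" and s: "s \<le> n" "s \<le> r"
    and d: "\<forall>t\<in>{1..s}. 0 < d t" and UEV: "U * E * V = D"
    using smith E by (auto simp: smith_decomposition_def D_def)
  have U: "U \<in> carrier_mat r r" and V: "V \<in> carrier_mat n n" using uU uV by (auto simp: unimodular_def)
  have w: "?w \<in> {..<r} \<rightarrow>\<^sub>E UNIV - {0}" using nz by auto
  have eq: "monom_map E (monom_map V z) = ?w \<longleftrightarrow> (\<forall>i<r. monom_map D z i = \<alpha> powi ((U *\<^sub>v h) $ i))"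
    if z: "z \<in> ?T" for z
  proof -
    have Vz: "monom_map V z \<in> ?T" using z by (intro monom_map_PiE[OF V]) auto
    have EVz: "monom_map E (monom_map V z) \<in> {..<r} \<rightarrow>\<^sub>E UNIV - {0}"
      using Vz by (intro monom_map_PiE[OF E]) auto
    have "monom_map D z = monom_map (U * E) (monom_map V z)"
      unfolding UEV[symmetric] using z U E V by (intro monom_map_mult[of _ r n]) auto
    also have "\<dots> = monom_map U (monom_map E (monom_map V z))"
      using Vz by (intro monom_map_mult[OF U E]) auto
    finally have D: "monom_map D z = monom_map U (monom_map E (monom_map V z))" .
    \<comment> \<open>Injectivity of \<open>monom_map U\<close> on nonzero tuples ensures that no
      solutions are gained by applying it.\<close>
    have "monom_map E (monom_map V z) = ?w \<longleftrightarrow> monom_map D z = monom_map U ?w"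
      unfolding D using inj_on_eq_iff[OF bij_betw_imp_inj_on[OF bij_betw_monom_map[OF uU]] EVz w] by simp
    also have "\<dots> \<longleftrightarrow> (\<forall>i<r. monom_map D z i = monom_map U ?w i)"
      using U by (auto simp: fun_eq_iff monom_map_def D_def restrict_def)
    finally show ?thesis using monom_map_powers[OF U h _ nz] by auto
  qed
  note bV = bij_betw_monom_map[OF uV, where 'a='a]
  have "bij_betw (monom_map V)
      {z \<in> ?T. \<forall>i<r. monom_map D z i = \<alpha> powi ((U *\<^sub>v h) $ i)} {x \<in> ?T. monom_map E x = ?w}"
    using bV by (rule bij_betw_Collect) (use eq in blast)
  from bij_betw_same_card[OF this] card_diag_solutions[OF \<alpha> s d D_def] show ?thesis by simp
qed

section \<open>Counting solutions with nonzero coordinates\<close>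

lemma finite_I_set [simp]: "finite (I_set rs ns l)" and finite_J_set [simp]: "finite (J_set rs ns l)"
  by (simp_all add: I_set_def J_set_def)

lemma length_stack [simp]: "length (stack rs ns l f g) = rho rs ns l"
  by (simp add: stack_def rho_def)

lemma map_stack: "map F (stack rs ns l f g) = stack rs ns l (\<lambda>i. F (f i)) (\<lambda>j. F (g j))"
  by (simp add: stack_def)

lemma stack_eq_iff:
  "stack rs ns l f g = stack rs ns l f' g' \<longleftrightarrow>
    (\<forall>i\<in>I_set rs ns l. f i = f' i) \<and> (\<forall>j\<in>J_set rs ns l. g j = g' j)"
  by (simp add: stack_def)

text \<open>Mediates between points, whose coordinates are numbered from 1, and matrix columns,
  numbered from 0.\<close>

lemma bij_betw_shift_PiE:
  "bij_betw (\<lambda>x. \<lambda>k\<in>{..<n}. x (Suc k)) ({1..n} \<rightarrow>\<^sub>E A) ({..<n} \<rightarrow>\<^sub>E A)"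
proof (rule bij_betw_byWitness[where f'="\<lambda>y. \<lambda>k\<in>{1..n}. y (k - 1)"], goal_cases)
  case 1
  show ?case
  proof
    fix x assume x: "x \<in> {1..n} \<rightarrow>\<^sub>E A"
    show "(\<lambda>k\<in>{1..n}. (\<lambda>k\<in>{..<n}. x (Suc k)) (k - 1)) = x"
    proof
      fix k
      show "(\<lambda>k\<in>{1..n}. (\<lambda>k\<in>{..<n}. x (Suc k)) (k - 1)) k = x k"
        using PiE_arb[OF x, of k] by (cases "k \<in> {1..n}") (auto simp: Suc_le_eq)
    qed
  qed
next
  case 2
  show ?case
  proof
    fix y assume y: "y \<in> {..<n} \<rightarrow>\<^sub>E A"
    show "(\<lambda>k\<in>{..<n}. (\<lambda>k\<in>{1..n}. y (k - 1)) (Suc k)) = y"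
    proof
      fix k
      show "(\<lambda>k\<in>{..<n}. (\<lambda>k\<in>{1..n}. y (k - 1)) (Suc k)) k = y k"
        using PiE_arb[OF y, of k] by (cases "k < n") auto
    qed
  qed
next
  case 3
  show ?case
  proof (intro image_subsetI restrict_PiE_iff[THEN iffD2] ballI)
    fix x k assume x: "x \<in> {1..n} \<rightarrow>\<^sub>E A" and "k \<in> {..<n}"
    then have "Suc k \<in> {1..n}" by simp
    then show "x (Suc k) \<in> A" by (rule PiE_mem[OF x])
  qed
next
  case 4
  show ?case
  proof (intro image_subsetI restrict_PiE_iff[THEN iffD2] ballI)
    fix y k assume y: "y \<in> {..<n} \<rightarrow>\<^sub>E A" and "k \<in> {1..n}"
    then have "k - 1 \<in> {..<n}" by (simp add: less_diff_conv2)
    then show "y (k - 1) \<in> A" by (rule PiE_mem[OF y])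
  qed
qed

text \<open>Prescribing all monomial values amounts to one equation for \<open>monom_map\<close> of
  the exponent matrix: \<open>h\<close> lists the discrete logarithms of \<open>u\<close> and
  \<open>v\<close> in the order of the rows, so its right-hand side has entries
  \<open>\<alpha> powi (h $ t)\<close>.\<close>

lemma card_monomial_fiber:
  fixes \<alpha> :: "'a::{field,finite}"
  assumes \<alpha>: "primitive_element \<alpha>"
    and smith: "smith_decomposition (exp_mat rs ns e1 e2 l) U V s d"
    and u: "\<forall>i\<in>I_set rs ns l. u i \<noteq> 0" and v: "\<forall>j\<in>J_set rs ns l. v j \<noteq> 0"
    and h_def: "h = vec_of_list (stack rs ns l (\<lambda>i. int (ind (CARD('a)) \<alpha> (u i))) (\<lambda>j. int (ind (CARD('a)) \<alpha> (v j))))"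
  shows "card {x \<in> {1..ns l} \<rightarrow>\<^sub>E UNIV - {0}.
      (\<forall>i\<in>I_set rs ns l. (\<Prod>k=1..ns l. x k ^ e1 i k) = u i) \<and>
      (\<forall>j\<in>J_set rs ns l. (\<Prod>k=1..ns l. x k ^ e2 j k) = v j)} =
    (if (\<forall>t\<in>{1..s}. int (gcd (CARD('a) - 1) (d t)) dvd (U *\<^sub>v h) $ (t - 1)) \<and>
        (\<forall>t\<in>{s + 1..rho rs ns l}. int (CARD('a) - 1) dvd (U *\<^sub>v h) $ (t - 1))
     then (CARD('a) - 1) ^ (ns l - s) * (\<Prod>t=1..s. gcd (CARD('a) - 1) (d t)) else 0)"
proof -
  let ?r = "rho rs ns l" and ?n = "ns l" and ?Q = "CARD('a) - 1"
  let ?E = "exp_mat rs ns e1 e2 l"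
  let ?sh = "\<lambda>x. \<lambda>k\<in>{..<?n}. x (Suc k) :: 'a"
  have E: "?E \<in> carrier_mat ?r ?n" by (simp add: exp_mat_def)
  have h: "h \<in> carrier_vec ?r" unfolding h_def by (intro carrier_vecI) simp
  have ht: "\<alpha> powi (h $ t) = stack rs ns l u v ! t" if "t < ?r" for t
  proof -
    have "\<alpha> powi (h $ t) = map ((powi) \<alpha>)
        (stack rs ns l (\<lambda>i. int (ind (CARD('a)) \<alpha> (u i))) (\<lambda>j. int (ind (CARD('a)) \<alpha> (v j)))) ! t"
      using that by (simp add: h_def vec_of_list_index)
    also have "map ((powi) \<alpha>)
        (stack rs ns l (\<lambda>i. int (ind (CARD('a)) \<alpha> (u i))) (\<lambda>j. int (ind (CARD('a)) \<alpha> (v j)))) = stack rs ns l u v"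
      unfolding map_stack stack_eq_iff using u v by (simp add: primitive_power_ind[OF \<alpha>])
    finally show ?thesis .
  qed
  have Et: "monom_map ?E (?sh x) t =
      stack rs ns l (\<lambda>i. \<Prod>k=1..?n. x k ^ e1 i k) (\<lambda>j. \<Prod>k=1..?n. x k ^ e2 j k) ! t" if "t < ?r" for t x
  proof -
    have "monom_map ?E (?sh x) t = (\<Prod>k<?n. x (Suc k) ^ (stack rs ns l e1 e2 ! t) (Suc k))"
      using that by (simp add: monom_map_def exp_mat_def)
    also have "\<dots> = (\<Prod>k=1..?n. x k ^ (stack rs ns l e1 e2 ! t) k)"
      by (rule prod.reindex_bij_witness[where i="\<lambda>k. k - 1" and j=Suc]) auto
    also have "\<dots> = map (\<lambda>e. \<Prod>k=1..?n. x k ^ e k) (stack rs ns l e1 e2) ! t"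
      using that by simp
    finally show ?thesis by (simp only: map_stack)
  qed
  have eq: "monom_map ?E (?sh x) = (\<lambda>t\<in>{..<?r}. \<alpha> powi (h $ t)) \<longleftrightarrow>
      (\<forall>i\<in>I_set rs ns l. (\<Prod>k=1..?n. x k ^ e1 i k) = u i) \<and>
      (\<forall>j\<in>J_set rs ns l. (\<Prod>k=1..?n. x k ^ e2 j k) = v j)" for x
  proof -
    have "monom_map ?E (?sh x) = (\<lambda>t\<in>{..<?r}. \<alpha> powi (h $ t)) \<longleftrightarrow>
        (\<forall>t<?r. monom_map ?E (?sh x) t = \<alpha> powi (h $ t))"
      by (auto simp: fun_eq_iff monom_map_def exp_mat_def restrict_def)
    also have "\<dots> \<longleftrightarrow> stack rs ns l (\<lambda>i. \<Prod>k=1..?n. x k ^ e1 i k) (\<lambda>j. \<Prod>k=1..?n. x k ^ e2 j k) =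
        stack rs ns l u v"
      by (simp add: list_eq_iff_nth_eq Et ht)
    finally show ?thesis by (simp only: stack_eq_iff)
  qed
  have "bij_betw ?sh
    {x \<in> {1..?n} \<rightarrow>\<^sub>E UNIV - {0}.
      (\<forall>i\<in>I_set rs ns l. (\<Prod>k=1..?n. x k ^ e1 i k) = u i) \<and>
      (\<forall>j\<in>J_set rs ns l. (\<Prod>k=1..?n. x k ^ e2 j k) = v j)}
    {y \<in> {..<?n} \<rightarrow>\<^sub>E UNIV - {0}. monom_map ?E y = (\<lambda>t\<in>{..<?r}. \<alpha> powi (h $ t))}"
    using bij_betw_shift_PiE by (rule bij_betw_Collect) (rule eq)
  \<comment> \<open>The count is now known; what remains moves the index \<open>t\<close> from a
    start at 0 to a start at 1.\<close>
  note this[THEN bij_betw_same_card, unfolded card_monom_map_fiber[OF \<alpha> E smith h]]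
  moreover have "(\<forall>t<s. int (gcd ?Q (d (Suc t))) dvd (U *\<^sub>v h) $ t) \<longleftrightarrow>
      (\<forall>t\<in>{1..s}. int (gcd ?Q (d t)) dvd (U *\<^sub>v h) $ (t - 1))"
  proof -
    have eq: "{1..s} = Suc ` {..<s}" by (simp add: image_Suc_lessThan)
    show ?thesis unfolding eq by (simp only: ball_simps(9) diff_Suc_1 Ball_def[of "{..<s}"] lessThan_iff)
  qed
  moreover have "(\<forall>t\<in>{s..<?r}. int ?Q dvd (U *\<^sub>v h) $ t) \<longleftrightarrow>
      (\<forall>t\<in>{s + 1..?r}. int ?Q dvd (U *\<^sub>v h) $ (t - 1))"
  proof -
    have eq: "{s + 1..?r} = Suc ` {s..<?r}" by (simp add: atLeastLessThanSuc_atLeastAtMost)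
    show ?thesis unfolding eq by (simp only: ball_simps(9) diff_Suc_1)
  qed
  moreover have "(\<Prod>t<s. gcd ?Q (d (Suc t))) = (\<Prod>t=1..s. gcd ?Q (d t))"
    by (rule prod.reindex_bij_witness[where i="\<lambda>k. k - 1" and j=Suc]) auto
  ultimately show ?thesis by (simp only:)
qed

text \<open>Solutions are sorted by the values \<open>m x\<close> of their monomials, which form a
  solution of the linear system \<open>Lin\<close>. Each fiber has \<open>K\<close> points if the
  divisibility condition \<open>C\<close> holds and none otherwise, so the total is
  \<open>H_count\<close> times \<open>K\<close>.\<close>

lemma card_nonzero_solutions:
  fixes \<alpha> :: "'a::{field,finite}"
  assumes \<alpha>: "primitive_element \<alpha>"
    and smith: "smith_decomposition (exp_mat rs ns e1 e2 l) U V s d"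
  shows "card {x \<in> {1..ns l} \<rightarrow>\<^sub>E UNIV - {0}.
      (\<Sum>i\<in>I_set rs ns l. a1 i * (\<Prod>k=1..ns l. x k ^ e1 i k)) = b1 \<and>
      (\<Sum>j\<in>J_set rs ns l. a2 j * (\<Prod>k=1..ns l. x k ^ e2 j k)) = b2} =
    L_count (CARD('a)) \<alpha> rs ns a1 a2 b1 b2 U s d l"
proof -
  let ?I = "I_set rs ns l" and ?J = "J_set rs ns l" and ?n = "ns l" and ?Q = "CARD('a) - 1"
  let ?T = "{1..?n} \<rightarrow>\<^sub>E UNIV - {0 :: 'a}"
  define h where "h = (\<lambda>(u, v). vec_of_list (stack rs ns l
    (\<lambda>i. int (ind (CARD('a)) \<alpha> (u i))) (\<lambda>j. int (ind (CARD('a)) \<alpha> (v j)))))"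
  define C where "C p \<longleftrightarrow> (\<forall>t\<in>{1..s}. int (gcd ?Q (d t)) dvd (U *\<^sub>v h p) $ (t - 1)) \<and>
        (\<forall>t\<in>{s + 1..rho rs ns l}. int ?Q dvd (U *\<^sub>v h p) $ (t - 1))" for p
  define Lin where "Lin = {(u, v). u \<in> ?I \<rightarrow>\<^sub>E UNIV - {0} \<and> v \<in> ?J \<rightarrow>\<^sub>E UNIV - {0} \<and>
       (\<Sum>i\<in>?I. a1 i * u i) = b1 \<and> (\<Sum>j\<in>?J. a2 j * v j) = b2}"
  define K where "K = ?Q ^ (?n - s) * (\<Prod>t=1..s. gcd ?Q (d t))"
  define m where "m x = (\<lambda>i\<in>?I. \<Prod>k=1..?n. x k ^ e1 i k, \<lambda>j\<in>?J. \<Prod>k=1..?n. x k ^ e2 j k)" for x :: "nat \<Rightarrow> 'a"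
  let ?S = "{x \<in> ?T.
      (\<Sum>i\<in>?I. a1 i * (\<Prod>k=1..?n. x k ^ e1 i k)) = b1 \<and>
      (\<Sum>j\<in>?J. a2 j * (\<Prod>k=1..?n. x k ^ e2 j k)) = b2}"
  \<comment> \<open>Monomials of a point with nonzero coordinates are nonzero, so only the two
    linear equations decide membership in \<open>Lin\<close>.\<close>
  have S: "?S = {x \<in> ?T. m x \<in> Lin}"
    by (auto simp: m_def Lin_def PiE_iff)
  have fin: "finite Lin"
    by (rule finite_subset[of _ "(?I \<rightarrow>\<^sub>E UNIV - {0}) \<times> (?J \<rightarrow>\<^sub>E UNIV - {0})"])
       (auto simp: Lin_def intro!: finite_PiE)
  have fT: "finite ?T" by (auto intro!: finite_PiE)
  have "card ?S = (\<Sum>x\<in>{x \<in> ?T. m x \<in> Lin}. 1)" unfolding S by simp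
  also have "\<dots> = (\<Sum>p\<in>Lin. card {x \<in> {x \<in> ?T. m x \<in> Lin}. m x = p})"
    using sum_fun_comp[of "{x \<in> ?T. m x \<in> Lin}" Lin m "\<lambda>_. 1 :: nat"] fin fT by auto
  also have "\<dots> = (\<Sum>p\<in>Lin. if C p then K else 0)"
  proof (intro sum.cong refl)
    fix p assume p: "p \<in> Lin"
    obtain u v where uv: "p = (u, v)" by fastforce
    have u: "u \<in> ?I \<rightarrow>\<^sub>E UNIV - {0}" and v: "v \<in> ?J \<rightarrow>\<^sub>E UNIV - {0}" using p by (auto simp: uv Lin_def)
    have mp: "m x = p \<longleftrightarrow> (\<forall>i\<in>?I. (\<Prod>k=1..?n. x k ^ e1 i k) = u i) \<and>
        (\<forall>j\<in>?J. (\<Prod>k=1..?n. x k ^ e2 j k) = v j)" for x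
    proof -
      have "restrict f A = g \<longleftrightarrow> (\<forall>i\<in>A. f i = g i)" if "g \<in> A \<rightarrow>\<^sub>E B" for f g :: "nat \<Rightarrow> 'a" and A B
        using that by (auto simp: fun_eq_iff PiE_iff extensional_def)
      from this[OF u] this[OF v] show ?thesis by (simp add: m_def uv)
    qed
    have "{x \<in> {x \<in> ?T. m x \<in> Lin}. m x = p} = {x \<in> ?T.
        (\<forall>i\<in>?I. (\<Prod>k=1..?n. x k ^ e1 i k) = u i) \<and>
        (\<forall>j\<in>?J. (\<Prod>k=1..?n. x k ^ e2 j k) = v j)}"
      unfolding mp[symmetric] using p by blast
    moreover have "\<forall>i\<in>?I. u i \<noteq> 0" "\<forall>j\<in>?J. v j \<noteq> 0" using u v by auto
    moreover have "h p = vec_of_list (stack rs ns l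
        (\<lambda>i. int (ind (CARD('a)) \<alpha> (u i))) (\<lambda>j. int (ind (CARD('a)) \<alpha> (v j))))"
      by (simp add: h_def uv)
    ultimately show "card {x \<in> {x \<in> ?T. m x \<in> Lin}. m x = p} = (if C p then K else 0)"
      unfolding C_def K_def using card_monomial_fiber[OF \<alpha> smith] by (simp only:)
  qed
  also have "\<dots> = card {p \<in> Lin. C p} * K"
    using fin by (simp add: sum.If_cases Int_def)
  also have "{p \<in> Lin. C p} = {(u, v). u \<in> ?I \<rightarrow>\<^sub>E (UNIV - {0}) \<and> v \<in> ?J \<rightarrow>\<^sub>E (UNIV - {0}) \<and>
       (\<Sum>i\<in>?I. a1 i * u i) = b1 \<and> (\<Sum>j\<in>?J. a2 j * v j) = b2 \<and> C (u, v)}"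
    by (auto simp: Lin_def)
  also have "card \<dots> * K = L_count (CARD('a)) \<alpha> rs ns a1 a2 b1 b2 U s d l"
    unfolding L_count_def H_count_def K_def C_def h_def Let_def by (simp only: split_conv mult.assoc)
  finally show ?thesis .
qed

section \<open>Stratification by the first zero coordinate\<close>

text \<open>Restricting to two disjoint index sets identifies functions on the union with pairs, so
  independent conditions on the parts multiply.\<close>

lemma card_PiE_Un_restrict:
  assumes ST: "S \<inter> T = {}" and W: "W \<subseteq> S \<rightarrow>\<^sub>E C" and Z: "Z \<subseteq> T \<rightarrow>\<^sub>E C"
  shows "card {x \<in> (S \<union> T) \<rightarrow>\<^sub>E C. restrict x S \<in> W \<and> restrict x T \<in> Z} = card W * card Z"
proof -
  let ?X = "{x \<in> (S \<union> T) \<rightarrow>\<^sub>E C. restrict x S \<in> W \<and> restrict x T \<in> Z}"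
  let ?f = "\<lambda>x. (restrict x S, restrict x T)"
  have "bij_betw ?f ?X (W \<times> Z)"
  proof (rule bij_betw_imageI)
    show "inj_on ?f ?X"
    proof (rule inj_onI)
      fix x y assume x: "x \<in> ?X" and y: "y \<in> ?X" and eq: "?f x = ?f y"
      have "x i = y i" for i
      proof -
        have "restrict x S i = restrict y S i" "restrict x T i = restrict y T i" using eq by auto
        moreover have "x i = undefined" "y i = undefined" if "i \<notin> S \<union> T"
          using x y that PiE_arb[of x] PiE_arb[of y] by blast+
        ultimately show ?thesis by (cases "i \<in> S"; cases "i \<in> T") auto
      qed
      then show "x = y" by blast
    qed
    show "?f ` ?X = W \<times> Z"
    proof (intro equalityI subsetI)
      fix p assume "p \<in> W \<times> Z"
      then obtain w z where p: "p = (w, z)" and w: "w \<in> W" and z: "z \<in> Z" by blast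
      have w': "w \<in> S \<rightarrow>\<^sub>E C" and z': "z \<in> T \<rightarrow>\<^sub>E C" using w z W Z by blast+
      \<comment> \<open>Outside both sets this takes the default value \<open>undefined\<close> of
        \<open>z\<close>, which keeps \<open>x\<close> extensional.\<close>
      define x where "x i = (if i \<in> S then w i else z i)" for i
      have xS: "restrict x S = w"
      proof
        fix i show "restrict x S i = w i" using PiE_arb[OF w', of i] by (simp add: x_def)
      qed
      have xT: "restrict x T = z"
      proof
        fix i
        have "i \<in> T \<Longrightarrow> i \<notin> S" using ST by blast
        then show "restrict x T i = z i" using PiE_arb[OF z', of i] by (simp add: x_def)
      qed
      have "x \<in> (S \<union> T) \<rightarrow>\<^sub>E C"
      proof (rule PiE_I)
        fix i assume "i \<in> S \<union> T"
        then show "x i \<in> C" using PiE_mem[OF w', of i] PiE_mem[OF z', of i] by (auto simp: x_def)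
      next
        fix i assume "i \<notin> S \<union> T"
        then show "x i = undefined" using PiE_arb[OF z', of i] by (simp add: x_def)
      qed
      then show "p \<in> ?f ` ?X" using xS xT w z p by (intro image_eqI[of _ _ x]) simp_all
    qed blast
  qed
  from bij_betw_same_card[OF this] show ?thesis by (simp add: card_cartesian_product)
qed

text \<open>Complementary count: from all functions those nonzero throughout \<open>{A<..B}\<close>
  are removed. Coordinates beyond \<open>B\<close> are free in both sets and supply the common
  factor.\<close>

lemma card_functions_with_zero:
  assumes "A \<le> B" "B \<le> (n::nat)"
  shows "card {z \<in> {A<..n} \<rightarrow>\<^sub>E (UNIV :: 'a::{zero,finite} set). \<exists>k\<in>{A<..B}. z k = 0} =
    CARD('a) ^ (n - B) * (CARD('a) ^ (B - A) - (CARD('a) - 1) ^ (B - A))"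
proof -
  let ?T = "{A<..n} \<rightarrow>\<^sub>E (UNIV :: 'a set)"
  let ?R = "\<Pi>\<^sub>E k\<in>{A<..n}. if k \<le> B then UNIV - {0 :: 'a} else UNIV"
  have eq: "{z \<in> ?T. \<exists>k\<in>{A<..B}. z k = 0} = ?T - ?R"
  proof -
    have "(\<forall>k\<in>{A<..n}. z k \<in> (if k \<le> B then UNIV - {0 :: 'a} else UNIV)) \<longleftrightarrow> (\<forall>k\<in>{A<..B}. z k \<noteq> 0)" for z
    proof
      assume L: "\<forall>k\<in>{A<..n}. z k \<in> (if k \<le> B then UNIV - {0 :: 'a} else UNIV)"
      show "\<forall>k\<in>{A<..B}. z k \<noteq> 0"
      proof
        fix k assume "k \<in> {A<..B}"
        then show "z k \<noteq> 0" using L[rule_format, of k] assms by simp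
      qed
    qed simp
    then have "z \<in> ?R \<longleftrightarrow> z \<in> ?T \<and> (\<forall>k\<in>{A<..B}. z k \<noteq> 0)" for z unfolding PiE_iff by blast
    then show ?thesis by blast
  qed
  have sub: "?R \<subseteq> ?T" by (auto simp: PiE_iff)
  have T: "card ?T = CARD('a) ^ (n - A)" by (simp add: card_PiE)
  have "card ?R = (\<Prod>k\<in>{A<..B} \<union> {B<..n}. card (if k \<le> B then UNIV - {0 :: 'a} else UNIV))"
    using assms by (simp add: card_PiE ivl_disj_un)
  also have "\<dots> = (\<Prod>k\<in>{A<..B}. CARD('a) - 1) * (\<Prod>k\<in>{B<..n}. CARD('a))"
    by (subst prod.union_disjoint) (auto simp: card_Diff_singleton intro!: arg_cong2[where f="(*)"] prod.cong)
  finally have R: "card ?R = CARD('a) ^ (n - B) * (CARD('a) - 1) ^ (B - A)" by simp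
  have "n - A = (n - B) + (B - A)" using assms by simp
  then have T': "card ?T = CARD('a) ^ (n - B) * CARD('a) ^ (B - A)" unfolding T by (simp only: power_add)
  have "finite ?R" by (auto intro!: finite_PiE)
  from card_Diff_subset[OF this sub] show ?thesis unfolding eq R T' by (simp only: diff_mult_distrib2)
qed

text \<open>Describes what survives of an equation when a later coordinate vanishes. For
  \<open>A = ns l\<close> it is the left-hand side underlying \<open>L_count\<close>; once
  \<open>A\<close> bounds every \<open>\<nu> i\<close>, no term is dropped.\<close>

definition trunc_sum ::
    "(nat \<Rightarrow> nat) \<Rightarrow> (nat \<Rightarrow> 'a::field) \<Rightarrow> (nat \<Rightarrow> nat \<Rightarrow> nat) \<Rightarrow> nat \<Rightarrow> nat \<Rightarrow> (nat \<Rightarrow> 'a) \<Rightarrow> 'a" where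
  "trunc_sum \<nu> a e r A x = (\<Sum>i\<in>{i \<in> {1..r}. \<nu> i \<le> A}. a i * (\<Prod>k=1..A. x k ^ e i k))"

text \<open>By \<open>gap\<close>, a term that is not kept reaches at least to \<open>B\<close>, so
  it contains \<open>x z\<close> with positive exponent and vanishes. A kept term has exponent 0
  beyond \<open>A\<close>, so its product may stop there.\<close>

lemma trunc_sum_eq_of_zero:
  assumes pos: "\<forall>i\<in>{1..r}. \<forall>k\<in>{1..\<nu> i}. e i k > 0"
    and zero: "\<forall>i\<in>{1..r}. \<forall>k\<in>{\<nu> i<..n}. e i k = 0"
    and top: "\<forall>i\<in>{1..r}. \<nu> i \<le> n"
    and gap: "\<forall>i\<in>{1..r}. \<nu> i \<le> A \<or> B \<le> \<nu> i"
    and z: "z \<in> {A<..B}" "x z = 0" and n: "B \<le> n"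
  shows "trunc_sum \<nu> a e r n x = trunc_sum \<nu> a e r A x"
proof -
  have "trunc_sum \<nu> a e r n x = (\<Sum>i\<in>{1..r}. a i * (\<Prod>k=1..n. x k ^ e i k))"
    unfolding trunc_sum_def using top by (intro sum.cong) auto
  also have "\<dots> = (\<Sum>i\<in>{i \<in> {1..r}. \<nu> i \<le> A}. a i * (\<Prod>k=1..A. x k ^ e i k))"
  proof (rule sum.mono_neutral_cong_right)
    show "\<forall>i\<in>{1..r} - {i \<in> {1..r}. \<nu> i \<le> A}. a i * (\<Prod>k=1..n. x k ^ e i k) = 0"
    proof
      fix i assume i: "i \<in> {1..r} - {i \<in> {1..r}. \<nu> i \<le> A}"
      then have "B \<le> \<nu> i" using gap by blast
      then have "e i z > 0" using pos i z by auto
      then have "x z ^ e i z = 0" using z by simp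
      moreover have "z \<in> {1..n}" using z n by simp
      ultimately have "(\<Prod>k=1..n. x k ^ e i k) = 0" by (intro prod_zero) blast+
      then show "a i * (\<Prod>k=1..n. x k ^ e i k) = 0" by simp
    qed
    fix i assume i: "i \<in> {i \<in> {1..r}. \<nu> i \<le> A}"
    have "(\<Prod>k=1..n. x k ^ e i k) = (\<Prod>k=1..A. x k ^ e i k)"
      by (rule prod.mono_neutral_right) (use i zero z n in auto)
    then show "a i * (\<Prod>k=1..n. x k ^ e i k) = a i * (\<Prod>k=1..A. x k ^ e i k)" by simp
  qed auto
  finally show ?thesis unfolding trunc_sum_def .
qed

lemma trunc_sum_restrict: "trunc_sum \<nu> a e r A (restrict x {1..A}) = trunc_sum \<nu> a e r A x"
  by (simp add: trunc_sum_def)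

text \<open>One layer of the stratification: points nonzero up to \<open>A\<close> either vanish
  somewhere in \<open>{A<..B}\<close> or are nonzero up to \<open>B\<close>. In the first kind the
  truncated system restricts only the first \<open>A\<close> coordinates, whence the
  product.\<close>

lemma card_solutions_step:
  fixes a1 a2 :: "nat \<Rightarrow> 'a::{field,finite}" and b1 b2 :: 'a
  assumes e1: "\<forall>i\<in>{1..r1}. \<forall>k\<in>{1..\<nu>1 i}. e1 i k > 0" "\<forall>i\<in>{1..r1}. \<forall>k\<in>{\<nu>1 i<..n}. e1 i k = 0"
    and e2: "\<forall>j\<in>{1..r2}. \<forall>k\<in>{1..\<nu>2 j}. e2 j k > 0" "\<forall>j\<in>{1..r2}. \<forall>k\<in>{\<nu>2 j<..n}. e2 j k = 0"
    and top: "\<forall>i\<in>{1..r1}. \<nu>1 i \<le> n" "\<forall>j\<in>{1..r2}. \<nu>2 j \<le> n"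
    and gap: "\<forall>i\<in>{1..r1}. \<nu>1 i \<le> A \<or> B \<le> \<nu>1 i" "\<forall>j\<in>{1..r2}. \<nu>2 j \<le> A \<or> B \<le> \<nu>2 j"
    and AB: "A \<le> B" "B \<le> n"
  defines "Sol \<equiv> \<lambda>m x. trunc_sum \<nu>1 a1 e1 r1 m x = b1 \<and> trunc_sum \<nu>2 a2 e2 r2 m x = b2"
  shows "card {x \<in> {1..n} \<rightarrow>\<^sub>E UNIV. Sol n x \<and> (\<forall>k\<in>{1..A}. x k \<noteq> 0)} =
    CARD('a) ^ (n - B) * (CARD('a) ^ (B - A) - (CARD('a) - 1) ^ (B - A)) *
      card {x \<in> {1..A} \<rightarrow>\<^sub>E UNIV - {0}. Sol A x} +
    card {x \<in> {1..n} \<rightarrow>\<^sub>E UNIV. Sol n x \<and> (\<forall>k\<in>{1..B}. x k \<noteq> 0)}"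
proof -
  let ?X = "{1..n} \<rightarrow>\<^sub>E (UNIV :: 'a set)"
  let ?W = "{x \<in> {1..A} \<rightarrow>\<^sub>E UNIV - {0}. Sol A x}"
  let ?Z = "{z \<in> {A<..n} \<rightarrow>\<^sub>E (UNIV :: 'a set). \<exists>k\<in>{A<..B}. z k = 0}"
  let ?N = "\<lambda>m. {x \<in> ?X. Sol n x \<and> (\<forall>k\<in>{1..m}. x k \<noteq> 0)}"
  define Y where "Y = {x \<in> ?X. Sol n x \<and> (\<forall>k\<in>{1..A}. x k \<noteq> 0) \<and> (\<exists>k\<in>{A<..B}. x k = 0)}"
  have fin: "finite ?X" by (auto intro!: finite_PiE)
  have un: "{1..B} = {1..A} \<union> {A<..B}" using AB by auto
  have "?N A = Y \<union> ?N B" unfolding un Y_def by blast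
  moreover have "Y \<inter> ?N B = {}" unfolding un Y_def by blast
  moreover have "finite Y" "finite (?N B)" using fin by (auto simp: Y_def)
  ultimately have "card (?N A) = card Y + card (?N B)" by (simp only: card_Un_disjoint)
  moreover have "card Y = card ?W * card ?Z"
  proof -
    have "{1..n} = {1..A} \<union> {A<..n}" using AB by auto
    moreover have "Y = {x \<in> ?X. restrict x {1..A} \<in> ?W \<and> restrict x {A<..n} \<in> ?Z}"
    proof -
      have Z: "restrict x {A<..n} \<in> ?Z \<longleftrightarrow> (\<exists>k\<in>{A<..B}. x k = 0)" for x
        using AB by auto
      have W: "restrict x {1..A} \<in> ?W \<longleftrightarrow> (\<forall>k\<in>{1..A}. x k \<noteq> 0) \<and> Sol A x" for x
        unfolding mem_Collect_eq restrict_PiE_iff Sol_def trunc_sum_restrict by auto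
      \<comment> \<open>A zero in \<open>{A<..B}\<close> makes full and truncated systems agree, so
        membership in \<open>Y\<close> separates into conditions on \<open>{1..A}\<close> and on
        \<open>{A<..n}\<close>.\<close>
      have "Sol n x \<longleftrightarrow> Sol A x" if "\<exists>k\<in>{A<..B}. x k = 0" for x
      proof -
        from that obtain z where z: "z \<in> {A<..B}" "x z = 0" by blast
        show ?thesis unfolding Sol_def
          using trunc_sum_eq_of_zero[where x=x and z=z, OF e1 top(1) gap(1) z AB(2)] 
            trunc_sum_eq_of_zero[where x=x and z=z, OF e2 top(2) gap(2) z AB(2)]
          by simp
      qed
      then show ?thesis unfolding W Z Y_def by blast
    qed
    moreover have "?W \<subseteq> {1..A} \<rightarrow>\<^sub>E UNIV"
      using PiE_mono[of "{1..A}" "\<lambda>_. UNIV - {0 :: 'a}" "\<lambda>_. UNIV"] by blast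
    moreover have "?Z \<subseteq> {A<..n} \<rightarrow>\<^sub>E UNIV" by blast
    moreover have "{1..A} \<inter> {A<..n} = {}" by auto
    ultimately show ?thesis
      using card_PiE_Un_restrict[of "{1..A}" "{A<..n}" ?W UNIV ?Z] by (simp only:)
  qed
  ultimately show ?thesis using card_functions_with_zero[OF AB, where 'a='a] by (simp only: mult.commute)
qed

section \<open>Telescoping over the ordered parameters\<close>

theorem theorem1p3:
  fixes p m q n :: nat
    and rs ns :: "nat \<Rightarrow> nat"
    and a1 a2 :: "nat \<Rightarrow> 'a::{field,finite}"
    and b1 b2 \<alpha> :: 'a
    and e1 e2 :: "nat \<Rightarrow> nat \<Rightarrow> nat"
    and U V :: "nat \<Rightarrow> int mat"
    and s :: "nat \<Rightarrow> nat"
    and d :: "nat \<Rightarrow> nat \<Rightarrow> nat"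
  assumes "prime p" "odd p" "m \<ge> 1" "q = p ^ m" "CARD('a) = q"
    and "1 \<le> rs 1" "rs 1 < rs 2" "1 \<le> rs 3" "rs 3 < rs 4"
    and "1 \<le> ns 1" "ns 1 < ns 2" "1 \<le> ns 3" "ns 3 < ns 4" "ns 1 \<le> ns 3"
    and "n = max (ns 2) (ns 4)"
    and "\<forall>i\<in>{1..rs 2}. a1 i \<noteq> 0"
    and "\<forall>j\<in>{1..rs 4}. a2 j \<noteq> 0"
    and "\<forall>i\<in>{1..rs 2}. \<forall>k\<in>{1..nu1 rs ns i}. e1 i k > 0"
    and "\<forall>i\<in>{1..rs 2}. \<forall>k\<in>{nu1 rs ns i<..n}. e1 i k = 0"
    and "\<forall>j\<in>{1..rs 4}. \<forall>k\<in>{1..nu2 rs ns j}. e2 j k > 0"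
    and "\<forall>j\<in>{1..rs 4}. \<forall>k\<in>{nu2 rs ns j<..n}. e2 j k = 0"
    and "primitive_element \<alpha>"
    and "\<forall>l\<in>{1..4}. smith_decomposition (exp_mat rs ns e1 e2 l) (U l) (V l) (s l) (d l)"
  shows
    "let N = card {x \<in> {1..n} \<rightarrow>\<^sub>E (UNIV :: 'a set).
               (\<Sum>i=1..rs 2. a1 i * (\<Prod>k=1..n. x k ^ e1 i k)) - b1 = 0 \<and>
               (\<Sum>j=1..rs 4. a2 j * (\<Prod>k=1..n. x k ^ e2 j k)) - b2 = 0};
         Ls = (\<lambda>l. L_count q \<alpha> rs ns a1 a2 b1 b2 (U l) (s l) (d l) l);
         M0 = N0 q n ns b1 b2; M1 = N1 q n ns b2 Ls; M2 = N2 q n ns Ls; M3 = N3 q ns Ls;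
         M4 = N4 ns Ls; M5 = N5 q ns Ls; M6 = N6 q ns b2 Ls
     in (ns 1 < ns 3 \<and> ns 3 < ns 2 \<and> ns 2 < ns 4 \<longrightarrow> N = M0 + M1 + M2 + M3 + M4) \<and>
        (ns 2 = ns 3 \<longrightarrow> N = M0 + M1 + M3 + M4) \<and>
        (ns 1 = ns 3 \<and> ns 2 < ns 4 \<longrightarrow> N = M0 + M2 + M3 + M4) \<and>
        (ns 1 < ns 3 \<and> ns 2 = ns 4 \<longrightarrow> N = M0 + M1 + M2 + M4) \<and>
        (ns 1 = ns 3 \<and> ns 2 = ns 4 \<longrightarrow> N = M0 + M2 + M4) \<and>
        (ns 1 < ns 3 \<and> ns 2 > ns 4 \<longrightarrow> N = M0 + M1 + M2 + M4 + M5) \<and>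
        (ns 1 = ns 3 \<and> ns 2 > ns 4 \<longrightarrow> N = M0 + M2 + M4 + M5) \<and>
        (ns 3 > ns 2 \<longrightarrow> N = M0 + M1 + M3 + M4 + M6)"
proof -
  let ?\<nu>1 = "nu1 rs ns" and ?\<nu>2 = "nu2 rs ns"
  define Sol where "Sol A x \<longleftrightarrow> trunc_sum ?\<nu>1 a1 e1 (rs 2) A x = b1 \<and> trunc_sum ?\<nu>2 a2 e2 (rs 4) A x = b2"
    for A and x :: "nat \<Rightarrow> 'a"
  \<comment> \<open>The count sought is \<open>Z 0\<close>, and \<open>Z n = R n\<close>. Every case
    telescopes from one to the other, each step splitting off a multiple of some
    \<open>R A\<close>.\<close>
  define R where "R A = card {x \<in> {1..A} \<rightarrow>\<^sub>E UNIV - {0}. Sol A x}" for A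
  define Z where "Z A = card {x \<in> {1..n} \<rightarrow>\<^sub>E UNIV. Sol n x \<and> (\<forall>k\<in>{1..A}. x k \<noteq> 0)}" for A
  define Ls where "Ls l = L_count q \<alpha> rs ns a1 a2 b1 b2 (U l) (s l) (d l) l" for l
  note ord = assms(10-15)
  have top: "\<forall>i\<in>{1..rs 2}. ?\<nu>1 i \<le> n" "\<forall>j\<in>{1..rs 4}. ?\<nu>2 j \<le> n"
    using ord by (auto simp: nu1_def nu2_def)
  \<comment> \<open>The \<open>gap\<close> conditions say that no parameter lies strictly between
    \<open>A\<close> and \<open>B\<close>.\<close>
  have step: "Z A = q ^ (n - B) * (q ^ (B - A) - (q - 1) ^ (B - A)) * R A + Z B"
    if "A \<le> B" "B \<le> n" and gap: "ns 1 \<le> A \<or> B \<le> ns 1" "ns 2 \<le> A \<or> B \<le> ns 2" "ns 3 \<le> A \<or> B \<le> ns 3" "ns 4 \<le> A \<or> B \<le> ns 4"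
    for A B
  proof -
    have "\<forall>i\<in>{1..rs 2}. ?\<nu>1 i \<le> A \<or> B \<le> ?\<nu>1 i" "\<forall>j\<in>{1..rs 4}. ?\<nu>2 j \<le> A \<or> B \<le> ?\<nu>2 j"
      using gap by (auto simp: nu1_def nu2_def)
    from card_solutions_step[OF assms(18-21) top this that(1,2), of a1 b1 a2 b2]
    show ?thesis unfolding Z_def R_def Sol_def assms(5) by (simp only:)
  qed
  have RL: "R (ns l) = Ls l" if "l \<in> {1..4}" for l
    using card_nonzero_solutions[OF assms(22), of rs ns e1 e2 l "U l" "V l" "s l" "d l" a1 b1 a2 b2] assms(23) that
    unfolding R_def Sol_def Ls_def trunc_sum_def I_set_def J_set_def assms(5) by blast
  \<comment> \<open>Below \<open>ns 3\<close> the second equation has lost all its terms and reads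
    \<open>0 = b2\<close>. This accounts for the condition \<open>b2 = 0\<close> in
    \<open>N1\<close> and \<open>N6\<close>.\<close>
  have R_zero: "R A = 0" if "A < ns 3" "b2 \<noteq> 0" for A
  proof -
    have "{j \<in> {1..rs 4}. ?\<nu>2 j \<le> A} = {}" using that ord by (auto simp: nu2_def)
    then have "\<not> Sol A x" for x unfolding Sol_def trunc_sum_def using that(2) by (simp only: sum.empty) simp
    then show ?thesis by (simp add: R_def)
  qed
  \<comment> \<open>Both sums are empty at 0, and there is exactly one extensional function on the
    empty index set.\<close>
  have R0: "R 0 = (if b1 = 0 \<and> b2 = 0 then 1 else 0)"
  proof -
    have "{i \<in> {1..rs 2}. ?\<nu>1 i \<le> 0} = {}" "{j \<in> {1..rs 4}. ?\<nu>2 j \<le> 0} = {}"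
      using ord by (auto simp: nu1_def nu2_def)
    then have "Sol 0 x \<longleftrightarrow> b1 = 0 \<and> b2 = 0" for x
      unfolding Sol_def trunc_sum_def by (simp only: sum.empty) auto
    then show ?thesis by (simp add: R_def)
  qed
  have Zn: "Z n = R n"
    unfolding Z_def R_def by (rule arg_cong[where f=card]) (auto simp: PiE_iff)
  have N: "card {x \<in> {1..n} \<rightarrow>\<^sub>E (UNIV :: 'a set).
               (\<Sum>i=1..rs 2. a1 i * (\<Prod>k=1..n. x k ^ e1 i k)) - b1 = 0 \<and>
               (\<Sum>j=1..rs 4. a2 j * (\<Prod>k=1..n. x k ^ e2 j k)) - b2 = 0} = Z 0"
  proof -
    have "{i \<in> {1..rs 2}. ?\<nu>1 i \<le> n} = {1..rs 2}" "{j \<in> {1..rs 4}. ?\<nu>2 j \<le> n} = {1..rs 4}"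
      using top by blast+
    then show ?thesis unfolding Z_def Sol_def trunc_sum_def by (simp only:) simp
  qed
  have Z0: "Z 0 = N0 q n ns b1 b2 + Z (ns 1)"
    using step[of 0 "ns 1"] ord R0 by (simp add: N0_def)
  have RL': "R (ns 1) = Ls 1" "R (ns 2) = Ls 2" "R (ns 3) = Ls 3" "R (ns 4) = Ls 4"
    by (rule RL; simp)+
  have L1: "Ls 1 = 0" if "ns 1 < ns 3" "b2 \<noteq> 0" using R_zero[OF that] RL' by simp
  have L2: "Ls 2 = 0" if "ns 2 < ns 3" "b2 \<noteq> 0" using R_zero[OF that] RL' by simp
  \<comment> \<open>The minimum is the next parameter after \<open>ns 1\<close>. For nonzero
    \<open>b2\<close> both \<open>N1\<close> and the split-off term vanish.\<close>
  have S13: "Z (ns 1) = N1 q n ns b2 Ls + Z (min (ns 2) (ns 3))" if "ns 1 < ns 3"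
  proof -
    let ?B = "min (ns 2) (ns 3)"
    have "Z (ns 1) = q ^ (n - ?B) * (q ^ (?B - ns 1) - (q - 1) ^ (?B - ns 1)) * R (ns 1) + Z ?B"
      by (rule step; use that ord in \<open>auto simp: min_def max_def\<close>)
    then show ?thesis unfolding N1_def RL' using that L1[OF that]
      by (cases "b2 = 0") (simp_all only: simp_thms if_True if_False mult_0_right less_irrefl_nat less_not_refl3 add_0)
  qed
  have S3: "Z (ns 3) = N2 q n ns Ls + Z (min (ns 2) (ns 4))" if "ns 3 < ns 2"
  proof -
    let ?B = "min (ns 2) (ns 4)"
    have "Z (ns 3) = q ^ (n - ?B) * (q ^ (?B - ns 3) - (q - 1) ^ (?B - ns 3)) * R (ns 3) + Z ?B"
      by (rule step; use that ord in \<open>auto simp: min_def max_def\<close>)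
    then show ?thesis unfolding N2_def RL' using that by (simp only: if_True)
  qed
  \<comment> \<open>Here \<open>n = ns 4\<close>, so no coordinates are free beyond the upper end
    and the power \<open>q ^ (n - ns 4)\<close> is 1. The same happens in \<open>S34\<close>, and in
    \<open>S42\<close> with \<open>n = ns 2\<close>.\<close>
  have S24: "Z (ns 2) = N3 q ns Ls + Z (ns 4)" if "ns 3 < ns 2" "ns 2 < ns 4"
  proof -
    have "Z (ns 2) = q ^ (n - ns 4) * (q ^ (ns 4 - ns 2) - (q - 1) ^ (ns 4 - ns 2)) * R (ns 2) + Z (ns 4)"
      by (rule step; use that ord in \<open>auto simp: min_def max_def\<close>)
    then show ?thesis unfolding N3_def RL' using that ord by simp
  qed
  have S34: "Z (ns 3) = N3 q ns Ls + Z (ns 4)" if "ns 2 \<le> ns 3"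
  proof -
    have "Z (ns 3) = q ^ (n - ns 4) * (q ^ (ns 4 - ns 3) - (q - 1) ^ (ns 4 - ns 3)) * R (ns 3) + Z (ns 4)"
      by (rule step; use that ord in \<open>auto simp: min_def max_def\<close>)
    then show ?thesis unfolding N3_def RL' using that ord by simp
  qed
  have S42: "Z (ns 4) = N5 q ns Ls + Z (ns 2)" if "ns 4 < ns 2"
  proof -
    have "Z (ns 4) = q ^ (n - ns 2) * (q ^ (ns 2 - ns 4) - (q - 1) ^ (ns 2 - ns 4)) * R (ns 4) + Z (ns 2)"
      by (rule step; use that ord in \<open>auto simp: min_def max_def\<close>)
    then show ?thesis unfolding N5_def RL' using that ord by simp
  qed
  have S23: "Z (ns 2) = N6 q ns b2 Ls + Z (ns 3)" if "ns 2 < ns 3"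
  proof -
    have n: "n = ns 4" using that ord by simp
    have "Z (ns 2) = q ^ (n - ns 3) * (q ^ (ns 3 - ns 2) - (q - 1) ^ (ns 3 - ns 2)) * R (ns 2) + Z (ns 3)"
      by (rule step; use that ord in \<open>auto simp: min_def max_def\<close>)
    then show ?thesis unfolding N6_def RL' n using that L2[OF that]
      by (cases "b2 = 0") (simp_all only: simp_thms if_True if_False mult_0_right add_0)
  qed
  have ZN4: "Z n = N4 ns Ls"
    unfolding Zn using ord by (simp add: N4_def RL' max_def)
  \<comment> \<open>Each case follows the parameters in increasing order from 0 to \<open>n\<close>,
    adding one term per step; coinciding parameters merge two steps and lose a term.
    \<open>N4\<close> is the end point, where all coordinates are nonzero.\<close>
  show ?thesis
    unfolding N Let_def Ls_def[abs_def, symmetric]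
  proof (intro conjI impI, goal_cases)
    case 1
    have m: "min (ns 2) (ns 3) = ns 3" "min (ns 2) (ns 4) = ns 2" "n = ns 4" using 1 ord by auto
    have c: "ns 1 < ns 3" "ns 3 < ns 2" "ns 2 < ns 4" using 1 ord by auto
    show ?case using Z0 S13[OF c(1)] S3[OF c(2)] S24[OF c(2) c(3)] ZN4 unfolding m by simp
  next
    case 2
    have m: "min (ns 2) (ns 3) = ns 3" "n = ns 4" using 2 ord by auto
    have c: "ns 1 < ns 3" "ns 2 \<le> ns 3" using 2 ord by auto
    show ?case using Z0 S13[OF c(1)] S34[OF c(2)] ZN4 2 unfolding m by simp
  next
    case 3
    have m: "min (ns 2) (ns 4) = ns 2" "n = ns 4" using 3 ord by auto
    have c: "ns 3 < ns 2" "ns 2 < ns 4" using 3 ord by auto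
    show ?case using Z0 S3[OF c(1)] S24[OF c(1) c(2)] ZN4 3 unfolding m by simp
  next
    case 4
    have m: "min (ns 2) (ns 3) = ns 3" "min (ns 2) (ns 4) = ns 2" "n = ns 4" using 4 ord by auto
    have c: "ns 1 < ns 3" "ns 3 < ns 2" using 4 ord by auto
    show ?case using Z0 S13[OF c(1)] S3[OF c(2)] ZN4 4 unfolding m by simp
  next
    case 5
    have m: "min (ns 2) (ns 4) = ns 2" "n = ns 4" using 5 ord by auto
    have c: "ns 3 < ns 2" using 5 ord by auto
    show ?case using Z0 S3[OF c] ZN4 5 unfolding m by simp
  next
    case 6
    have m: "min (ns 2) (ns 3) = ns 3" "min (ns 2) (ns 4) = ns 4" "n = ns 2" using 6 ord by auto
    have c: "ns 1 < ns 3" "ns 3 < ns 2" "ns 4 < ns 2" using 6 ord by auto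
    show ?case using Z0 S13[OF c(1)] S3[OF c(2)] S42[OF c(3)] ZN4 unfolding m by simp
  next
    case 7
    have m: "min (ns 2) (ns 4) = ns 4" "n = ns 2" using 7 ord by auto
    have c: "ns 3 < ns 2" "ns 4 < ns 2" using 7 ord by auto
    show ?case using Z0 S3[OF c(1)] S42[OF c(2)] ZN4 7 unfolding m by simp
  next
    case 8
    have m: "min (ns 2) (ns 3) = ns 2" "n = ns 4" using 8 ord by auto
    have c: "ns 1 < ns 3" "ns 2 < ns 3" "ns 2 \<le> ns 3" using 8 ord by auto
    show ?case using Z0 S13[OF c(1)] S23[OF c(2)] S34[OF c(3)] ZN4 unfolding m by simp
  qed
qed

end
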